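(* Let $E$ be a Hausdorff locally convex space over the field $\mathbf{F}$, where $\mathbf{F}=\mathbb{R}$ or $\mathbf{F}=\mathbb{C}$. If $E$ has a vector subspace which, with the topology induced from $E$, is an infinite-dimensional Fréchet space, then $E$ has $\mathbb{T}^{\omega}$ as a quotient group.
   Context: A Fréchet space is a complete metrizable locally convex space. $\mathbb{T}$ denotes the compact unit circle group $\{z\in\mathbb{C}: |z|=1\}$ under multiplication with its usual topology, and $\mathbb{T}^{\omega}$ is the product of countably infinitely many copies of $\mathbb{T}$ (indexed by $\omega=\{0,1,2,\dots\}$) with the product topology and coordinatewise multiplication. A locally convex space $E$ is regarded as a topological group under addition. A topological group $E$ has a topological group $G$ as a quotient group if $G$ is topologically isomorphic to $E/N$ (with the quotient topology) for some closed normal subgroup $N$ of $E$; equivalently (for Hausdorff $G$), there is a continuous open surjective group homomorphism $E\to G$. The homomorphism is not required to be linear in any sense, and $N$ need not be a vector subspace. *)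

theory Defs
  imports "HOL-Analysis.Analysis" "HOL-Algebra.Coset" "HOL-Algebra.Product_Groups"
begin

text \<open>
  Vector spaces are given by a scalar multiplication \<open>sc\<close> on an abelian group type (so that real
  and complex scalars are treated alike), and topologies by the type \<open>'a topology\<close>.  The predicates
  below are relative to a carrier \<open>V\<close>, a linear subspace of the type, so that they apply both to the
  ambient space and to a subspace with its induced topology.
\<close>

definition topological_vector_space ::
  "('f::real_normed_field \<Rightarrow> 'e::ab_group_add \<Rightarrow> 'e) \<Rightarrow> 'e set \<Rightarrow> 'e topology \<Rightarrow> bool" where
  "topological_vector_space sc V T \<longleftrightarrow>
     vector_space sc \<and> module.subspace sc V \<and> topspace T = V \<and>
     continuous_map (prod_topology T T) T (\<lambda>(x, y). x + y) \<and>
     continuous_map (prod_topology euclidean T) T (\<lambda>(c, x). sc c x)"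

text \<open>The library constant \<open>convex\<close> is tied to the class \<open>real_vector\<close>; this is its analogue for
  \<open>sc\<close>, with the real coefficients embedded in the scalar field.\<close>

definition convex_wrt ::
  "('f::real_normed_field \<Rightarrow> 'e::ab_group_add \<Rightarrow> 'e) \<Rightarrow> 'e set \<Rightarrow> bool" where
  "convex_wrt sc C \<longleftrightarrow>
     (\<forall>x\<in>C. \<forall>y\<in>C. \<forall>t::real. 0 \<le> t \<and> t \<le> 1 \<longrightarrow>
        sc (of_real (1 - t)) x + sc (of_real t) y \<in> C)"

text \<open>The set \<open>C\<close> below is a neighbourhood of \<open>0\<close>, not necessarily open.\<close>

definition locally_convex_space ::
  "('f::real_normed_field \<Rightarrow> 'e::ab_group_add \<Rightarrow> 'e) \<Rightarrow> 'e set \<Rightarrow> 'e topology \<Rightarrow> bool" where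
  "locally_convex_space sc V T \<longleftrightarrow>
     topological_vector_space sc V T \<and>
     (\<forall>U. openin T U \<and> 0 \<in> U \<longrightarrow>
        (\<exists>O' C. openin T O' \<and> 0 \<in> O' \<and> O' \<subseteq> C \<and> C \<subseteq> U \<and> convex_wrt sc C))"

text \<open>Completeness refers to the canonical (translation-invariant) uniformity of \<open>T\<close>.\<close>

definition cauchy_filter_in :: "'e::ab_group_add topology \<Rightarrow> 'e filter \<Rightarrow> bool" where
  "cauchy_filter_in T F \<longleftrightarrow>
     F \<noteq> bot \<and>
     (\<forall>U. openin T U \<and> 0 \<in> U \<longrightarrow>
        (\<exists>A \<subseteq> topspace T. (\<forall>\<^sub>F x in F. x \<in> A) \<and> (\<forall>x\<in>A. \<forall>y\<in>A. x - y \<in> U)))"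

definition uniformly_complete :: "'e::ab_group_add topology \<Rightarrow> bool" where
  "uniformly_complete T \<longleftrightarrow>
     (\<forall>F. cauchy_filter_in T F \<longrightarrow> (\<exists>l. limitin T (\<lambda>x. x) l F))"

definition frechet_space ::
  "('f::real_normed_field \<Rightarrow> 'e::ab_group_add \<Rightarrow> 'e) \<Rightarrow> 'e set \<Rightarrow> 'e topology \<Rightarrow> bool" where
  "frechet_space sc V T \<longleftrightarrow>
     locally_convex_space sc V T \<and> metrizable_space T \<and> uniformly_complete T"

definition infinite_dimensional ::
  "('f::field \<Rightarrow> 'e::ab_group_add \<Rightarrow> 'e) \<Rightarrow> 'e set \<Rightarrow> bool" where
  "infinite_dimensional sc V \<longleftrightarrow>
     \<not> (\<exists>B. finite B \<and> \<not> module.dependent sc B \<and> module.span sc B = V)"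

definition additive_group :: "'e::ab_group_add set \<Rightarrow> 'e monoid" where
  "additive_group V = \<lparr>carrier = V, mult = (+), one = 0\<rparr>"

definition quotient_group_topology ::
  "('a, 'm) monoid_scheme \<Rightarrow> 'a topology \<Rightarrow> 'a set \<Rightarrow> 'a set topology" where
  "quotient_group_topology G T N =
     topology (\<lambda>\<U>. \<U> \<subseteq> carrier (G Mod N) \<and> openin T {x \<in> topspace T. N #>\<^bsub>G\<^esub> x \<in> \<U>})"

lemma openin_quotient_group_topology:
  "openin (quotient_group_topology G T N) \<U> \<longleftrightarrow>
     \<U> \<subseteq> carrier (G Mod N) \<and> openin T {x \<in> topspace T. N #>\<^bsub>G\<^esub> x \<in> \<U>}"
proof -
  let ?P = "\<lambda>\<U>. \<U> \<subseteq> carrier (G Mod N) \<and> openin T {x \<in> topspace T. N #>\<^bsub>G\<^esub> x \<in> \<U>}"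
  have "istopology ?P"
    unfolding istopology_def
  proof (intro conjI allI impI)
    fix A B assume A: "?P A" and B: "?P B"
    have "{x \<in> topspace T. N #>\<^bsub>G\<^esub> x \<in> A \<inter> B} =
        {x \<in> topspace T. N #>\<^bsub>G\<^esub> x \<in> A} \<inter> {x \<in> topspace T. N #>\<^bsub>G\<^esub> x \<in> B}" by auto
    then show "openin T {x \<in> topspace T. N #>\<^bsub>G\<^esub> x \<in> A \<inter> B}"
      using A B by (simp add: openin_Int)
    show "A \<inter> B \<subseteq> carrier (G Mod N)" using A by blast
  next
    fix K assume K: "\<forall>A\<in>K. ?P A"
    have "{x \<in> topspace T. N #>\<^bsub>G\<^esub> x \<in> \<Union>K} = (\<Union>A\<in>K. {x \<in> topspace T. N #>\<^bsub>G\<^esub> x \<in> A})"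
      by auto
    then show "openin T {x \<in> topspace T. N #>\<^bsub>G\<^esub> x \<in> \<Union>K}"
      using K by auto
    show "\<Union>K \<subseteq> carrier (G Mod N)" using K by blast
  qed
  then show ?thesis
    by (simp add: quotient_group_topology_def topology_inverse')
qed

lemma quotient_map_quotient_group_topology:
  assumes "topspace T = carrier G"
  shows "quotient_map T (quotient_group_topology G T N) (\<lambda>x. N #>\<^bsub>G\<^esub> x)"
proof -
  have car: "carrier (G Mod N) = (\<lambda>x. N #>\<^bsub>G\<^esub> x) ` topspace T"
    using assms by (auto simp: FactGroup_def RCOSETS_def)
  have "{x \<in> topspace T. N #>\<^bsub>G\<^esub> x \<in> carrier (G Mod N)} = topspace T"
    by (auto simp: car)
  then have "openin (quotient_group_topology G T N) (carrier (G Mod N))"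
    by (simp add: openin_quotient_group_topology)
  then have "topspace (quotient_group_topology G T N) = carrier (G Mod N)"
    by (metis openin_quotient_group_topology openin_subset openin_topspace subset_antisym)
  then show ?thesis
    by (auto simp: quotient_map_def car openin_quotient_group_topology)
qed

text \<open>\<open>has_quotient_group G T H S\<close>: the topological group \<open>(H, S)\<close> is topologically isomorphic to
  \<open>G / N\<close> for some closed normal subgroup \<open>N\<close> of the topological group \<open>(G, T)\<close>.\<close>

definition has_quotient_group ::
  "('a, 'm) monoid_scheme \<Rightarrow> 'a topology \<Rightarrow> ('b, 'n) monoid_scheme \<Rightarrow> 'b topology \<Rightarrow> bool" where
  "has_quotient_group G T H S \<longleftrightarrow>
     (\<exists>N h. N \<lhd> G \<and> closedin T N \<and> h \<in> iso (G Mod N) H \<and>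
        homeomorphic_map (quotient_group_topology G T N) S h)"

definition circle_group :: "complex monoid" where
  "circle_group = \<lparr>carrier = sphere 0 1, mult = (*), one = 1\<rparr>"

definition torus_omega :: "(nat \<Rightarrow> complex) monoid" where
  "torus_omega = product_group UNIV (\<lambda>_. circle_group)"

definition torus_omega_topology :: "(nat \<Rightarrow> complex) topology" where
  "torus_omega_topology = product_topology (\<lambda>_. top_of_set (sphere 0 1)) UNIV"

end

theory Submission
  imports Defs
begin

text \<open>
  In the subspace \<open>W\<close> choose a sequence \<open>x\<^sub>n\<close> with continuous real-linear functionals \<open>f\<^sub>n\<close> on the
  whole space such that \<open>f\<^sub>n(x\<^sub>m)\<close> is \<open>1\<close> for \<open>m = n\<close> and \<open>0\<close> otherwise, the \<open>x\<^sub>n\<close> being so small that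
  \<open>\<Sum> s\<^sub>n x\<^sub>n\<close> converges in \<open>W\<close> for all coefficients in \<open>[0, 1]\<close>.  The homomorphism
  \<open>x \<mapsto> (exp (2\<pi>i f\<^sub>n(x)))\<^sub>n\<close> is onto since every point of the torus has coordinates \<open>exp (2\<pi>i s\<^sub>n)\<close> with
  \<open>s\<^sub>n \<in> [0, 1)\<close>.  It is open since a tail of the series lies in any given neighbourhood of \<open>0\<close>
  whatever its coefficients are, so that only finitely many \<open>s\<^sub>n\<close> have to be small.
\<close>

section \<open>Sublinear functionals\<close>

text \<open>Scaling is demanded as an inequality for positive \<open>c\<close> alone: using it for
  \<open>1 / c\<close> as well gives equality, and \<open>p 0 = 0\<close> then follows from
  \<open>p 0 = 2 * p 0\<close>.\<close>

definition sublinear :: "(real \<Rightarrow> 'e::ab_group_add \<Rightarrow> 'e) \<Rightarrow> ('e \<Rightarrow> real) \<Rightarrow> bool" where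
  "sublinear sc p \<longleftrightarrow> (\<forall>x y. p (x + y) \<le> p x + p y) \<and> (\<forall>c x. 0 < c \<longrightarrow> p (sc c x) \<le> c * p x)"

lemma sublinearI:
  assumes "\<And>x y. p (x + y) \<le> p x + p y" "\<And>c x. 0 < c \<Longrightarrow> p (sc c x) \<le> c * p x"
  shows "sublinear sc p"
  using assms by (simp add: sublinear_def)

lemma sublinear_add: "sublinear sc p \<Longrightarrow> p (x + y) \<le> p x + p y"
  by (simp add: sublinear_def)

lemma sublinear_scale_le: "sublinear sc p \<Longrightarrow> 0 < c \<Longrightarrow> p (sc c x) \<le> c * p x"
  by (simp add: sublinear_def)

locale real_vs = vector_space sc for sc :: "real \<Rightarrow> 'e::ab_group_add \<Rightarrow> 'e"
begin

lemma sublinear_scale: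
  assumes "sublinear sc p" "0 < c"
  shows "p (sc c x) = c * p x"
proof (rule antisym)
  have "p (sc (1 / c) (sc c x)) \<le> (1 / c) * p (sc c x)"
    using assms by (intro sublinear_scale_le) auto
  then show "c * p x \<le> p (sc c x)"
    using assms(2) by (simp add: field_simps)
qed (use assms in \<open>rule sublinear_scale_le\<close>)

lemma sublinear_zero:
  assumes "sublinear sc p"
  shows "p 0 = 0"
  using sublinear_scale[OF assms, of 2 0] by simp

lemma sublinear_minus_ge:
  assumes "sublinear sc p"
  shows "- p (- x) \<le> p x"
  using sublinear_add[OF assms, of x "- x"] sublinear_zero[OF assms] by simp

text \<open>Values \<open>q x\<close> and \<open>r y\<close> may come from different members of
  \<open>S\<close>; a common lower member \<open>s\<close> bounds both from below, and its
  subadditivity passes to the infimum.\<close>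

lemma sublinear_INF:
  assumes "S \<noteq> {}" and S: "\<And>q. q \<in> S \<Longrightarrow> sublinear sc q"
    and bdd: "\<And>x. bdd_below ((\<lambda>q. q x) ` S)"
    and directed: "\<And>q r. q \<in> S \<Longrightarrow> r \<in> S \<Longrightarrow> \<exists>s\<in>S. s \<le> q \<and> s \<le> r"
  shows "sublinear sc (\<lambda>x. INF q\<in>S. q x)" (is "sublinear sc ?u")
proof (rule sublinearI)
  fix x y
  have "?u (x + y) - q x \<le> r y" if qr: "q \<in> S" "r \<in> S" for q r
  proof -
    obtain s where s: "s \<in> S" "s \<le> q" "s \<le> r" using directed qr by blast
    have "?u (x + y) \<le> s (x + y)" using bdd s(1) by (rule cINF_lower)
    also have "\<dots> \<le> s x + s y" using S[OF s(1)] by (rule sublinear_add)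
    finally show ?thesis using le_funD[OF s(2), of x] le_funD[OF s(3), of y] by linarith
  qed
  then have "?u (x + y) - q x \<le> ?u y" if "q \<in> S" for q
    using that \<open>S \<noteq> {}\<close> by (intro cINF_greatest) auto
  then have "?u (x + y) - ?u y \<le> ?u x"
    using \<open>S \<noteq> {}\<close> by (intro cINF_greatest) (auto simp: algebra_simps)
  then show "?u (x + y) \<le> ?u x + ?u y" by linarith
next
  fix c :: real and x assume c: "0 < c"
  have "?u (sc c x) / c \<le> q x" if "q \<in> S" for q
    using cINF_lower[OF bdd that, of "sc c x"] sublinear_scale[OF S[OF that] c, of x] c
    by (simp add: field_simps)
  then have "?u (sc c x) / c \<le> ?u x"
    using \<open>S \<noteq> {}\<close> by (intro cINF_greatest)
  then show "?u (sc c x) \<le> c * ?u x"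
    using c by (simp add: field_simps)
qed

text \<open>The new functional is the infimum over \<open>t \<ge> 0\<close> of
  \<open>q (x + sc t y) - t * q y\<close>. Taking \<open>t = 0\<close> keeps it below
  \<open>q\<close>, and \<open>t = 1\<close> at \<open>- y\<close> gives the bound
  \<open>- q y\<close>. A minimal \<open>q\<close> coincides with its reduction, which forces
  \<open>q (- y) \<le> - q y\<close>.\<close>

lemma sublinear_reduce:
  assumes q: "sublinear sc q"
  obtains r where "sublinear sc r" "r \<le> q" "r (- y) \<le> - q y"
proof
  define A where "A x = (\<lambda>t. q (x + sc t y) - t * q y) ` {0..}" for x
  let ?r = "\<lambda>x. Inf (A x)"
  \<comment> \<open>A lower bound that does not depend on \<open>t\<close>, from splitting
    \<open>sc t y\<close> as \<open>(x + sc t y) + (- x)\<close>; it makes the infimum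
    finite.\<close>
  have low: "- q (- x) \<le> q (x + sc t y) - t * q y" if "0 \<le> t" for x t
  proof -
    have "q (sc t y) = t * q y"
      using that sublinear_zero[OF q] sublinear_scale[OF q, of t y] by (cases "t = 0") auto
    then show ?thesis
      using sublinear_add[OF q, of "x + sc t y" "- x"] by simp
  qed
  have ne: "A x \<noteq> {}" for x by (simp add: A_def)
  have bdd: "bdd_below (A x)" for x
    by (rule bdd_belowI[of _ "- q (- x)"]) (auto simp: A_def low)
  have le: "?r x \<le> q (x + sc t y) - t * q y" if "0 \<le> t" for x t
    using that by (intro cInf_lower bdd) (auto simp: A_def)
  show "?r \<le> q"
    using le[of 0] by (auto intro: le_funI)
  show "?r (- y) \<le> - q y"
    using le[of 1 "- y"] sublinear_zero[OF q] by simp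
  show "sublinear sc ?r"
  proof (rule sublinearI)
    fix x z
    \<comment> \<open>Parameters \<open>s\<close> at \<open>x\<close> and \<open>t\<close> at
      \<open>z\<close> combine to \<open>s + t\<close> at \<open>x + z\<close>. The infimum is then
      taken over \<open>t\<close> first and over \<open>s\<close> afterwards.\<close>
    have "?r (x + z) - (q (x + sc s y) - s * q y) \<le> q (z + sc t y) - t * q y"
      if "0 \<le> s" "0 \<le> t" for s t
    proof -
      have "?r (x + z) \<le> q (x + z + sc (s + t) y) - (s + t) * q y"
        using that by (intro le) simp
      also have "x + z + sc (s + t) y = (x + sc s y) + (z + sc t y)"
        by (simp add: scale_left_distrib algebra_simps)
      finally show ?thesis
        using sublinear_add[OF q, of "x + sc s y" "z + sc t y"] by (simp add: algebra_simps)
    qed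
    then have "?r (x + z) - (q (x + sc s y) - s * q y) \<le> ?r z" if "0 \<le> s" for s
      using that by (intro cInf_greatest ne) (auto simp: A_def)
    then have "?r (x + z) - ?r z \<le> ?r x"
      by (intro cInf_greatest ne) (auto simp: A_def algebra_simps)
    then show "?r (x + z) \<le> ?r x + ?r z" by linarith
  next
    fix c :: real and x assume c: "0 < c"
    have "?r (sc c x) / c \<le> q (x + sc s y) - s * q y" if "0 \<le> s" for s
    proof -
      have "?r (sc c x) \<le> q (sc c x + sc (c * s) y) - (c * s) * q y"
        using that c by (intro le) simp
      also have "sc c x + sc (c * s) y = sc c (x + sc s y)"
        by (simp add: scale_right_distrib)
      also have "q \<dots> = c * q (x + sc s y)"
        using q c by (rule sublinear_scale)
      finally show ?thesis
        using c by (simp add: field_simps)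
    qed
    then have "?r (sc c x) / c \<le> ?r x"
      by (intro cInf_greatest ne) (auto simp: A_def)
    then show "?r (sc c x) \<le> c * ?r x"
      using c by (simp add: field_simps)
  qed
qed

text \<open>Zorn's lemma for the reversed pointwise order. The pointwise infimum of a nonempty chain
  is finite because each member satisfies \<open>- p (- x) \<le> - q (- x) \<le> q x\<close>, and it
  is sublinear because a chain is directed.\<close>

lemma ex_minimal_sublinear:
  assumes p: "sublinear sc p"
  obtains q where "sublinear sc q" "q \<le> p" "\<And>r. sublinear sc r \<Longrightarrow> r \<le> q \<Longrightarrow> r = q"
proof -
  let ?A = "{q. sublinear sc q \<and> q \<le> p}"
  have "\<exists>m\<in>?A. \<forall>a\<in>?A. m \<ge> a \<longrightarrow> a = m"
  proof (rule predicate_Zorn)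
    show "partial_order_on ?A (relation_of (\<ge>) ?A)"
      by (rule partial_order_on_relation_ofI) auto
    fix C assume "C \<in> Chains (relation_of (\<ge>) ?A)"
    then have CA: "C \<subseteq> ?A" and chain: "\<And>q r. q \<in> C \<Longrightarrow> r \<in> C \<Longrightarrow> q \<le> r \<or> r \<le> q"
      by (auto simp: Chains_def relation_of_def)
    show "\<exists>u\<in>?A. \<forall>a\<in>C. a \<ge> u"
    proof (cases "C = {}")
      case False
      let ?u = "\<lambda>x. INF q\<in>C. q x"
      have bdd: "bdd_below ((\<lambda>q. q x) ` C)" for x
      proof (rule bdd_belowI2)
        fix q assume "q \<in> C"
        then have "sublinear sc q" "q (- x) \<le> p (- x)" using CA by (auto simp: le_fun_def)
        then show "- p (- x) \<le> q x" using sublinear_minus_ge[of q x] by linarith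
      qed
      have u: "?u \<le> q" if "q \<in> C" for q
        using that bdd by (intro le_funI cINF_lower)
      have "sublinear sc ?u"
      proof (rule sublinear_INF[OF False _ bdd])
        show "\<exists>s\<in>C. s \<le> q \<and> s \<le> r" if "q \<in> C" "r \<in> C" for q r
          using chain[OF that] that by blast
      qed (use CA in auto)
      moreover have "?u \<le> p" using u CA False by (blast intro: order_trans)
      ultimately show ?thesis using u by blast
    qed (use p in auto)
  qed
  then obtain m where "sublinear sc m" "m \<le> p" "\<And>a. sublinear sc a \<Longrightarrow> a \<le> p \<Longrightarrow> a \<le> m \<Longrightarrow> a = m"
    by auto
  then show thesis
    by (intro that[of m]) (auto intro: order_trans)
qed

text \<open>A minimal sublinear functional is odd since it cannot be reduced further, hence additive.\<close>

theorem hahn_banach: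
  assumes p: "sublinear sc p"
  obtains f where "\<And>x y. f (x + y) = f x + f y" "\<And>c x. f (sc c x) = c * f x"
    "f \<le> p" "p x\<^sub>0 \<le> f x\<^sub>0"
proof -
  \<comment> \<open>Reducing \<open>p\<close> in the direction \<open>x\<^sub>0\<close> before
    minimising gives every functional below \<open>p'\<close> the bound \<open>- p x\<^sub>0\<close>
    at \<open>- x\<^sub>0\<close>; oddness turns it into the lower bound at
    \<open>x\<^sub>0\<close>.\<close>
  obtain p' where p': "sublinear sc p'" "p' \<le> p" "p' (- x\<^sub>0) \<le> - p x\<^sub>0"
    using sublinear_reduce[OF p] .
  obtain f where f: "sublinear sc f" "f \<le> p'"
    and minimal: "\<And>r. sublinear sc r \<Longrightarrow> r \<le> f \<Longrightarrow> r = f"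
    using ex_minimal_sublinear[OF p'(1)] by blast
  have odd: "f (- y) = - f y" for y
  proof (rule antisym)
    obtain r where "sublinear sc r" "r \<le> f" "r (- y) \<le> - f y"
      using sublinear_reduce[OF f(1)] .
    with minimal[of r] show "f (- y) \<le> - f y" by simp
    show "- f y \<le> f (- y)" using sublinear_minus_ge[OF f(1), of y] by linarith
  qed
  show thesis
  proof
    \<comment> \<open>Subadditivity at \<open>- x\<close> and \<open>- y\<close> becomes the reverse
      inequality by oddness.\<close>
    show "f (x + y) = f x + f y" for x y
      using sublinear_add[OF f(1), of x y] sublinear_add[OF f(1), of "- x" "- y"]
        odd[of x] odd[of y] odd[of "x + y"] by simp
    show "f (sc c x) = c * f x" for c x
    proof (cases c "0::real" rule: linorder_cases)
      case less
      then show ?thesis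
        using sublinear_scale[OF f(1), of "- c" x] odd[of "sc c x"] by simp
    qed (use f(1) sublinear_zero sublinear_scale in auto)
    show "f \<le> p" using f(2) p'(2) by (rule order_trans)
    show "p x\<^sub>0 \<le> f x\<^sub>0"
      using le_funD[OF f(2), of "- x\<^sub>0"] p'(3) odd[of "x\<^sub>0"] by linarith
  qed
qed

end

section \<open>Real locally convex spaces\<close>

text \<open>Real scalars suffice because the coordinates are real-linear functionals; a complex
  space enters by restriction of scalars.\<close>

locale real_lcs = real_vs sc for sc :: "real \<Rightarrow> 'e::ab_group_add \<Rightarrow> 'e" +
  fixes T :: "'e topology"
  assumes topspace_eq [simp]: "topspace T = UNIV"
    and add_cont: "continuous_map (prod_topology T T) T (\<lambda>(x, y). x + y)"
    and scale_cont: "continuous_map (prod_topology euclidean T) T (\<lambda>(c, x). sc c x)"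
    and convex_nbhd: "openin T U \<Longrightarrow> 0 \<in> U \<Longrightarrow>
      \<exists>O' C. openin T O' \<and> 0 \<in> O' \<and> O' \<subseteq> C \<and> C \<subseteq> U \<and> convex_wrt sc C"
begin

section \<open>Neighbourhoods of zero\<close>

lemma continuous_map_add:
  assumes "continuous_map X T f" "continuous_map X T g"
  shows "continuous_map X T (\<lambda>x. f x + g x)"
  using continuous_map_compose[OF continuous_map_pairedI[OF assms] add_cont] by (simp add: o_def)

lemma continuous_map_scale:
  assumes "continuous_map X euclideanreal c" "continuous_map X T f"
  shows "continuous_map X T (\<lambda>x. sc (c x) (f x))"
  using continuous_map_compose[OF continuous_map_pairedI[OF assms] scale_cont] by (simp add: o_def)

lemma continuous_map_affine: "continuous_map T T (\<lambda>x. sc c x + a)"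
  by (intro continuous_map_add continuous_map_scale continuous_map_id[unfolded id_def]) auto

lemma openin_affine:
  assumes "openin T U"
  shows "openin T {x. sc c x + a \<in> U}"
  using openin_continuous_map_preimage[OF continuous_map_affine assms] by simp

lemma openin_uminus:
  assumes "openin T U"
  shows "openin T {x. - x \<in> U}"
  using openin_affine[OF assms, of "- 1" 0] by simp

lemma small_scalars:
  assumes "openin T U" "0 \<in> U"
  obtains e where "0 < e" "\<And>c. \<bar>c\<bar> < e \<Longrightarrow> sc c x \<in> U"
proof -
  have "continuous_map euclideanreal T (\<lambda>c. sc c x)"
    by (intro continuous_map_scale) auto
  then have "open {c. sc c x \<in> U}"
    using openin_continuous_map_preimage[OF _ assms(1)] by fastforce
  moreover have "0 \<in> {c. sc c x \<in> U}"
    using assms by simp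
  ultimately obtain e where "0 < e" "ball 0 e \<subseteq> {c. sc c x \<in> U}"
    by (meson openE)
  then show thesis
    by (intro that[of e]) (auto simp: subset_eq)
qed

lemma absorbing:
  assumes "openin T U" "0 \<in> U"
  obtains c where "0 < c" "sc c x \<in> U"
proof -
  obtain e where "0 < e" "\<And>c. \<bar>c\<bar> < e \<Longrightarrow> sc c x \<in> U"
    using small_scalars[OF assms] by blast
  then show thesis
    by (intro that[of "e / 2"]) auto
qed

lemma convex_wrt_star:
  assumes "convex_wrt sc C" "0 \<in> C" "x \<in> C" "0 \<le> t" "t \<le> 1"
  shows "sc t x \<in> C"
proof -
  have "sc (of_real (1 - t)) 0 + sc (of_real t) x \<in> C"
    using assms unfolding convex_wrt_def by blast
  then show ?thesis by simp
qed

text \<open>Continuity of addition together with a convex, hence star-shaped, neighbourhood for the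
  first summand. The factor \<open>t\<close> is what later makes the estimates of series uniform in
  coefficients from \<open>[0, 1]\<close>.\<close>

lemma half_nbhd:
  assumes "openin T U" "0 \<in> U"
  obtains U' where "openin T U'" "0 \<in> U'"
    "\<And>x y t. x \<in> U' \<Longrightarrow> y \<in> U' \<Longrightarrow> 0 \<le> t \<Longrightarrow> t \<le> 1 \<Longrightarrow> sc t x + y \<in> U"
proof -
  have "openin (prod_topology T T) {z \<in> topspace (prod_topology T T). (\<lambda>(x, y). x + y) z \<in> U}"
    using add_cont assms(1) by (rule openin_continuous_map_preimage)
  then have "openin (prod_topology T T) {(x, y). x + y \<in> U}"
    by (simp add: case_prod_unfold)
  moreover have "(0, 0) \<in> {(x, y). x + y \<in> U}"
    using assms(2) by simp
  ultimately have "\<exists>A B. openin T A \<and> openin T B \<and> 0 \<in> A \<and> 0 \<in> B \<and>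
      A \<times> B \<subseteq> {(x, y). x + y \<in> U}"
    by (simp only: openin_prod_topology_alt)
  then obtain A B where AB: "openin T A" "openin T B" "0 \<in> A" "0 \<in> B"
    "A \<times> B \<subseteq> {(x, y). x + y \<in> U}"
    by blast
  obtain O' C where C: "openin T O'" "0 \<in> O'" "O' \<subseteq> C" "C \<subseteq> A" "convex_wrt sc C"
    using convex_nbhd[OF AB(1,3)] by blast
  show thesis
  proof (rule that)
    show "openin T (O' \<inter> B)" using C(1) AB(2) by (rule openin_Int)
    show "0 \<in> O' \<inter> B" using C(2) AB(4) by blast
    fix x y and t :: real
    assume xy: "x \<in> O' \<inter> B" "y \<in> O' \<inter> B" "0 \<le> t" "t \<le> 1"
    have "0 \<in> C" "x \<in> C" using C xy(1) by blast+
    then have "sc t x \<in> A"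
      using convex_wrt_star[OF C(5) _ _ xy(3,4)] C(4) by blast
    then have "(sc t x, y) \<in> A \<times> B" using xy(2) by blast
    then show "sc t x + y \<in> U" using AB(5) by auto
  qed
qed

text \<open>Serves the finitely many leading coordinates, whose coefficients may be negative and so
  escape the estimate for coefficients in \<open>[0, 1]\<close>.\<close>

lemma small_combination:
  assumes "openin T U" "0 \<in> U"
  obtains e where "0 < e" "\<And>s. (\<And>k. k < (N::nat) \<Longrightarrow> \<bar>s k\<bar> < e) \<Longrightarrow> (\<Sum>k<N. sc (s k) (x k)) \<in> U"
proof -
  have "\<exists>e>0. \<forall>s. (\<forall>k<N. \<bar>s k\<bar> < e) \<longrightarrow> (\<Sum>k<N. sc (s k) (x k)) \<in> U"
    using assms
  proof (induction N arbitrary: U)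
    case 0
    then show ?case by (auto intro: exI[of _ 1])
  next
    case (Suc N)
    obtain U' where U': "openin T U'" "0 \<in> U'"
      and sub: "\<And>x y t. x \<in> U' \<Longrightarrow> y \<in> U' \<Longrightarrow> 0 \<le> t \<Longrightarrow> t \<le> 1 \<Longrightarrow> sc t x + y \<in> U"
      using half_nbhd[OF Suc.prems] by blast
    obtain e1 where e1: "0 < e1"
      "\<And>s. \<forall>k<N. \<bar>s k\<bar> < e1 \<Longrightarrow> (\<Sum>k<N. sc (s k) (x k)) \<in> U'"
      using Suc.IH[OF U'] by blast
    obtain e2 where e2: "0 < e2" "\<And>c. \<bar>c\<bar> < e2 \<Longrightarrow> sc c (x N) \<in> U'"
      using small_scalars[OF U'] by blast
    show ?case
    proof (intro exI conjI allI impI)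
      fix s :: "nat \<Rightarrow> real" assume s: "\<forall>k<Suc N. \<bar>s k\<bar> < min e1 e2"
      then have "(\<Sum>k<N. sc (s k) (x k)) \<in> U'" "sc (s N) (x N) \<in> U'"
        by (auto intro!: e1 e2)
      from sub[OF this, of 1] show "(\<Sum>k<Suc N. sc (s k) (x k)) \<in> U" by simp
    qed (use e1 e2 in simp)
  qed
  then show thesis using that by blast
qed

section \<open>Continuous real-linear functionals on the whole space\<close>

definition dual :: "('e \<Rightarrow> real) \<Rightarrow> bool" where
  "dual f \<longleftrightarrow> (\<forall>x y. f (x + y) = f x + f y) \<and> (\<forall>c x. f (sc c x) = c * f x) \<and>
     continuous_map T euclideanreal f"

lemma dual_add: "dual f \<Longrightarrow> f (x + y) = f x + f y"
  and dual_scale: "dual f \<Longrightarrow> f (sc c x) = c * f x"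
  and dual_continuous: "dual f \<Longrightarrow> continuous_map T euclideanreal f"
  by (auto simp: dual_def)

lemma dual_zero: "dual f \<Longrightarrow> f 0 = 0"
  using dual_add[of f 0 0] by simp

lemma dual_diff: "dual f \<Longrightarrow> f (x - y) = f x - f y"
  using dual_add[of f "x - y" y] by simp

lemma dual_sum: "dual f \<Longrightarrow> f (\<Sum>i\<in>I. h i) = (\<Sum>i\<in>I. f (h i))"
  by (induction I rule: infinite_finite_induct) (auto simp: dual_zero[of f] dual_add[of f])

lemma dual_cmult:
  assumes "dual f"
  shows "dual (\<lambda>x. a * f x)"
  using assms by (auto simp: dual_def algebra_simps intro!: continuous_map_real_mult_left)

text \<open>The shape in which a functional is corrected to vanish on earlier vectors.\<close>

lemma dual_minus_sum:
  assumes "dual g" "finite I" "\<And>i. i \<in> I \<Longrightarrow> dual (h i)"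
  shows "dual (\<lambda>x. g x - (\<Sum>i\<in>I. a i * h i x))"
proof -
  have lin: "(\<Sum>i\<in>I. a i * h i (x + y)) = (\<Sum>i\<in>I. a i * h i x) + (\<Sum>i\<in>I. a i * h i y)"
    "(\<Sum>i\<in>I. a i * h i (sc c x)) = c * (\<Sum>i\<in>I. a i * h i x)" for x y c
    using assms(3) unfolding sum_distrib_left sum.distrib[symmetric]
    by (auto simp: dual_def algebra_simps intro!: sum.cong)
  have "continuous_map T euclideanreal (\<lambda>x. g x - (\<Sum>i\<in>I. a i * h i x))"
    using assms by (intro continuous_map_diff continuous_map_sum continuous_map_real_mult_left)
      (auto intro: dual_continuous)
  then show ?thesis
    using assms(1) by (simp add: dual_def lin right_diff_distrib)
qed

text \<open>Hahn-Banach for the Minkowski gauge of a convex neighbourhood \<open>C\<close> that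
  misses \<open>x\<close>. The gauge is at least \<open>1\<close> at \<open>x\<close>, so
  \<open>f x\<close> is positive and can be normalised; it is at most \<open>1\<close> on
  \<open>O'\<close>, which makes \<open>f\<close> continuous.\<close>

lemma separating_dual:
  assumes "openin T U" "0 \<in> U" "x \<notin> U"
  obtains f where "dual f" "f x = 1"
proof -
  obtain O' C where O': "openin T O'" "0 \<in> O'" "O' \<subseteq> C"
    and C: "C \<subseteq> U" "convex_wrt sc C"
    using convex_nbhd[OF assms(1,2)] by blast
  have "0 \<in> C" using O' by blast
  define A where "A y = {r. 0 < r \<and> sc (1 / r) y \<in> C}" for y
  let ?p = "\<lambda>y. Inf (A y)"
  have bdd: "bdd_below (A y)" for y
    by (rule bdd_belowI[of _ 0]) (auto simp: A_def)
  have ne: "A y \<noteq> {}" for y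
  proof -
    obtain c where "0 < c" "sc c y \<in> O'" using absorbing[OF O'(1,2)] .
    then have "1 / c \<in> A y" using O' by (auto simp: A_def)
    then show ?thesis by blast
  qed
  have "sublinear sc ?p"
  proof (rule sublinearI)
    fix y z
    \<comment> \<open>The combination of \<open>y / r\<close> and \<open>z / s\<close> with weights
      \<open>r / (r + s)\<close> and \<open>s / (r + s)\<close> is
      \<open>(y + z) / (r + s)\<close>.\<close>
    have "r + s \<in> A (y + z)" if "r \<in> A y" "s \<in> A z" for r s
    proof -
      have rs: "0 < r" "0 < s" "sc (1 / r) y \<in> C" "sc (1 / s) z \<in> C"
        using that by (auto simp: A_def)
      have eq: "1 - s / (r + s) = r / (r + s)" using rs by (simp add: field_simps)
      have "0 \<le> s / (r + s)" "s / (r + s) \<le> 1" using rs by (simp_all add: field_simps)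
      then have "sc (of_real (1 - s / (r + s))) (sc (1 / r) y) + sc (of_real (s / (r + s))) (sc (1 / s) z) \<in> C"
        using C(2) rs unfolding convex_wrt_def by blast
      then have "sc (1 / (r + s)) (y + z) \<in> C"
        using rs unfolding eq by (simp add: scale_right_distrib)
      then show ?thesis using rs by (simp add: A_def)
    qed
    then have le: "?p (y + z) \<le> r + s" if "r \<in> A y" "s \<in> A z" for r s
      using that by (intro cInf_lower bdd) auto
    have "?p (y + z) - r \<le> ?p z" if "r \<in> A y" for r
    proof (intro cInf_greatest ne)
      fix s assume "s \<in> A z"
      from le[OF that this] show "?p (y + z) - r \<le> s" by linarith
    qed
    then have "?p (y + z) - ?p z \<le> ?p y"
      by (intro cInf_greatest ne) (auto simp: algebra_simps)
    then show "?p (y + z) \<le> ?p y + ?p z" by linarith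
  next
    fix c :: real and y assume c: "0 < c"
    have "?p (sc c y) \<le> c * r" if "r \<in> A y" for r
      using that c by (intro cInf_lower bdd) (auto simp: A_def)
    then have "?p (sc c y) / c \<le> ?p y"
      using c by (intro cInf_greatest ne) (auto simp: field_simps)
    then show "?p (sc c y) \<le> c * ?p y"
      using c by (simp add: field_simps)
  qed
  then obtain f where add: "\<And>y z. f (y + z) = f y + f z"
    and scale: "\<And>c y. f (sc c y) = c * f y" and f: "f \<le> ?p" "?p x \<le> f x"
    using hahn_banach by blast
  have "1 \<le> ?p x"
  proof (intro cInf_greatest ne)
    fix r assume r: "r \<in> A x"
    \<comment> \<open>For \<open>r < 1\<close>, shrinking the point \<open>sc (1 / r) x\<close> of
      \<open>C\<close> by \<open>r\<close> would put \<open>x\<close> itself into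
      \<open>C\<close>.\<close>
    show "1 \<le> r"
    proof (rule ccontr)
      assume "\<not> 1 \<le> r"
      then have "0 \<le> r" "r \<le> 1" and C': "sc (1 / r) x \<in> C" using r by (auto simp: A_def)
      then have "sc r (sc (1 / r) x) \<in> C"
        using convex_wrt_star[OF C(2) \<open>0 \<in> C\<close> C'] by blast
      then show False using r C(1) assms(3) by (auto simp: A_def)
    qed
  qed
  then have pos: "1 \<le> f x" using f(2) by linarith
  have f_le: "f y \<le> 1" if "y \<in> O'" for y
  proof -
    have "?p y \<le> 1" using that O' by (intro cInf_lower bdd) (auto simp: A_def)
    then show ?thesis using le_funD[OF f(1), of y] by linarith
  qed
  have minus: "f (- y) = - f y" for y
    using scale[of "- 1" y] by simp
  have "continuous_map T euclideanreal f"
    unfolding continuous_map_def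
  proof (intro conjI allI impI)
    fix S :: "real set" assume "openin euclideanreal S"
    then have "open S" by simp
    show "openin T {y \<in> topspace T. f y \<in> S}"
    proof (subst openin_subopen, intro ballI)
      fix y assume "y \<in> {y \<in> topspace T. f y \<in> S}"
      then have "f y \<in> S" by simp
      then obtain e where e: "0 < e" "cball (f y) e \<subseteq> S"
        using \<open>open S\<close> unfolding open_contains_cball by blast
      \<comment> \<open>Both \<open>(z - y) / e\<close> and its negative are required to lie in
        \<open>O'\<close>, since \<open>O'\<close> need not be symmetric; this bounds
        \<open>f z - f y\<close> by \<open>e\<close> from both sides.\<close>
      let ?B = "{z. sc (1 / e) z + sc (- 1 / e) y \<in> O'} \<inter> {z. sc (- 1 / e) z + sc (1 / e) y \<in> O'}"
      have "f z \<in> S" if "z \<in> ?B" for z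
      proof -
        have "f (sc (1 / e) z + sc (- 1 / e) y) \<le> 1" "f (sc (- 1 / e) z + sc (1 / e) y) \<le> 1"
          using that by (auto intro: f_le)
        then have "\<bar>f y - f z\<bar> \<le> e"
          unfolding add scale using e(1) by (simp add: field_simps abs_le_iff)
        then show ?thesis using e(2) by (auto simp: dist_real_def)
      qed
      moreover have "openin T ?B" using O'(1) by (intro openin_Int openin_affine)
      moreover have "y \<in> ?B" using O'(2) by (simp flip: scale_left_distrib)
      ultimately show "\<exists>B. openin T B \<and> y \<in> B \<and> B \<subseteq> {y \<in> topspace T. f y \<in> S}"
        by (intro exI[of _ ?B]) auto
    qed
  qed auto
  then have "dual f" using add scale by (simp add: dual_def)
  show thesis
  proof
    show "dual (\<lambda>y. (1 / f x) * f y)" using \<open>dual f\<close> by (rule dual_cmult)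
    show "(1 / f x) * f x = 1" using pos by simp
  qed
qed

end

section \<open>Biorthogonal sequences in a Frechet subspace\<close>

locale frechet_subspace = real_lcs +
  fixes W
  assumes Hausdorff: "Hausdorff_space T"
    and subspace_W: "subspace W"
    and metrizable: "metrizable_space (subtopology T W)"
    and complete: "uniformly_complete (subtopology T W)"
    and infinite_dim: "infinite_dimensional sc W"
begin

text \<open>First countability of \<open>W\<close> gives a countable base at \<open>0\<close>;
  dependent choice shrinks each member further so that it halves into its predecessor.\<close>

lemma ex_nbhd_base:
  obtains V where "\<And>n::nat. openin (subtopology T W) (V n)" "\<And>n. 0 \<in> V n"
    "\<And>n x y t. x \<in> V (Suc n) \<Longrightarrow> y \<in> V (Suc n) \<Longrightarrow> 0 \<le> t \<Longrightarrow> t \<le> 1 \<Longrightarrow> sc t x + y \<in> V n"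
    "\<And>U. openin T U \<Longrightarrow> 0 \<in> U \<Longrightarrow> \<exists>n. V n \<subseteq> U"
proof -
  let ?T = "subtopology T W"
  have W0: "0 \<in> W" using subspace_W by (rule subspace_0)
  have "first_countable ?T" using metrizable by (rule metrizable_imp_first_countable)
  moreover have "0 \<in> topspace ?T" using W0 by simp
  ultimately have "\<exists>\<B>. countable \<B> \<and> (\<forall>V\<in>\<B>. openin ?T V) \<and>
      (\<forall>U. openin ?T U \<and> 0 \<in> U \<longrightarrow> (\<exists>V\<in>\<B>. 0 \<in> V \<and> V \<subseteq> U))"
    by (simp only: first_countable_def)
  then obtain \<B> where *: "countable \<B> \<and> (\<forall>V\<in>\<B>. openin ?T V) \<and>
      (\<forall>U. openin ?T U \<and> 0 \<in> U \<longrightarrow> (\<exists>V\<in>\<B>. 0 \<in> V \<and> V \<subseteq> U))" ..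
  then have \<B>: "countable \<B>" "\<And>U. U \<in> \<B> \<Longrightarrow> openin ?T U"
    by simp_all
  have base: "\<exists>B\<in>\<B>. 0 \<in> B \<and> B \<subseteq> U" if "openin ?T U" "0 \<in> U" for U
    using * that by simp
  have openW: "openin ?T W" using openin_topspace[of ?T] by simp
  then have "\<B> \<noteq> {}" using base[OF openW W0] by blast
  \<comment> \<open>Members of the countable family that miss \<open>0\<close> are replaced by the
    harmless neighbourhood \<open>W\<close>.\<close>
  define B where "B n = (if 0 \<in> from_nat_into \<B> n then from_nat_into \<B> n else W)" for n
  have B: "openin ?T (B n)" "0 \<in> B n" for n
    using \<B>(2) from_nat_into[OF \<open>\<B> \<noteq> {}\<close>] openW W0 by (auto simp: B_def)
  have B_base: "\<exists>n. B n \<subseteq> U" if "openin T U" "0 \<in> U" for U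
  proof -
    have "openin ?T (W \<inter> U)" using that(1) by (rule openin_subtopology_Int2)
    moreover have "0 \<in> W \<inter> U" using W0 that(2) by blast
    ultimately obtain B' where B': "B' \<in> \<B>" "0 \<in> B'" "B' \<subseteq> W \<inter> U"
      using base by blast
    obtain n where "from_nat_into \<B> n = B'"
      using from_nat_into_surj[OF \<B>(1) B'(1)] by blast
    then have "B n \<subseteq> U" using B' by (auto simp: B_def)
    then show ?thesis ..
  qed
  let ?P = "\<lambda>n V. openin ?T V \<and> 0 \<in> V \<and> V \<subseteq> B n"
  let ?Q = "\<lambda>(n::nat) V V'. \<forall>x\<in>V'. \<forall>y\<in>V'. \<forall>t. 0 \<le> t \<longrightarrow> t \<le> 1 \<longrightarrow> sc t x + y \<in> V"
  have "\<exists>V. \<forall>n. ?P n (V n) \<and> ?Q n (V n) (V (Suc n))"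
  proof (rule dependent_nat_choice)
    show "\<exists>V. ?P 0 V" using B by blast
    fix V n assume V: "?P n V"
    then obtain U where U: "openin T U" "V = U \<inter> W" by (auto simp: openin_subtopology)
    then have "0 \<in> U" using V by blast
    obtain U' where U': "openin T U'" "0 \<in> U'"
      and half: "\<And>x y t. x \<in> U' \<Longrightarrow> y \<in> U' \<Longrightarrow> 0 \<le> t \<Longrightarrow> t \<le> 1 \<Longrightarrow> sc t x + y \<in> U"
      using half_nbhd[OF U(1) \<open>0 \<in> U\<close>] by blast
    \<comment> \<open>The factor \<open>W\<close> keeps the combinations inside the subspace, and
      \<open>B (Suc n)\<close> keeps the sequence a base.\<close>
    let ?V = "W \<inter> U' \<inter> B (Suc n)"
    have "openin ?T ?V"
      using openin_subtopology_Int2[OF U'(1)] B(1) by (rule openin_Int)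
    moreover have "sc t x + y \<in> V" if "x \<in> ?V" "y \<in> ?V" "0 \<le> t" "t \<le> 1" for x y t
    proof -
      have "sc t x + y \<in> U" using that by (intro half) auto
      moreover have "sc t x + y \<in> W"
        using that by (intro subspace_add subspace_scale subspace_W) auto
      ultimately show ?thesis using U(2) by blast
    qed
    moreover have "0 \<in> ?V" using W0 U'(2) B(2) by blast
    ultimately have "?P (Suc n) ?V \<and> ?Q n V ?V" by blast
    then show "\<exists>V'. ?P (Suc n) V' \<and> ?Q n V V'" ..
  qed
  then obtain V where *: "\<forall>n. ?P n (V n) \<and> ?Q n (V n) (V (Suc n))" ..
  have V: "?P n (V n)" "?Q n (V n) (V (Suc n))" for n
    using *[THEN spec, of n] by simp_all
  show thesis
  proof
    show "\<exists>n. V n \<subseteq> U" if U: "openin T U" "0 \<in> U" for U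
    proof -
      obtain n where "B n \<subseteq> U" using B_base[OF U] by blast
      then have "V n \<subseteq> U" using V(1)[of n] by (meson order_trans)
      then show ?thesis ..
    qed
    show "openin ?T (V n)" "0 \<in> V n" for n using V(1)[of n] by simp_all
    show "sc t x + y \<in> V n" if "x \<in> V (Suc n)" "y \<in> V (Suc n)" "0 \<le> t" "t \<le> 1" for n x y t
      using V(2)[of n] that by simp
  qed
qed

lemma separate_points:
  assumes "x \<noteq> 0"
  obtains f where "dual f" "f x = 1"
proof -
  have "\<exists>U V. openin T U \<and> openin T V \<and> 0 \<in> U \<and> x \<in> V \<and> disjnt U V"
    using Hausdorff assms by (simp add: Hausdorff_space_def)
  then obtain U where "openin T U" "0 \<in> U" "x \<notin> U"
    by (auto simp: disjnt_iff)
  then show thesis using separating_dual that by blast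
qed

text \<open>\<open>infinite_dimensional\<close> excludes finite bases, so the finite set is first
  thinned to an independent one with the same span.\<close>

lemma not_finitely_spanned:
  assumes "finite S" "S \<subseteq> W"
  obtains w where "w \<in> W" "w \<notin> span S"
proof -
  obtain B where B: "B \<subseteq> S" "independent B" "S \<subseteq> span B"
    by (rule maximal_independent_subset)
  have "span B \<noteq> W"
    using infinite_dim B(1,2) assms(1) unfolding infinite_dimensional_def by (blast dest: finite_subset)
  moreover have "span S = span B"
    using B(1,3) by (metis span_mono span_minimal subspace_span subset_antisym)
  moreover have "span S \<subseteq> W" using assms(2) subspace_W by (rule span_minimal)
  ultimately show thesis using that by blast
qed

text \<open>A Gram-Schmidt recursion on pairs: a vector outside the earlier span is made orthogonal
  to the earlier functionals, and a functional not vanishing on it is corrected on the earlier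
  vectors. Shrinking the vector by \<open>c\<close> into \<open>V n\<close> is compensated by the
  factor \<open>1 / c\<close> on the functional.\<close>

lemma ex_biorthogonal:
  assumes V: "\<And>n::nat. openin (subtopology T W) (V n)" "\<And>n. 0 \<in> V n"
  obtains x f where "\<And>n. x n \<in> V n" "\<And>n. dual (f n)" "\<And>n m. f n (x m) = (if m = n then 1 else 0)"
proof -
  \<comment> \<open>Each new pair must annihilate all earlier pairs in both directions, so the
    choice depends on the whole history and not on the last stage alone.\<close>
  let ?P = "\<lambda>F n r. fst r \<in> V n \<and> dual (snd r) \<and> snd r (fst r) = 1 \<and>
    (\<forall>m<n. snd r (fst (F m)) = 0 \<and> snd (F m) (fst r) = 0)"
  have "\<exists>F :: nat \<Rightarrow> 'a \<times> ('a \<Rightarrow> real). \<forall>n. ?P F n (F n)"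
  proof (rule dependent_wellorder_choice)
    fix n and F :: "nat \<Rightarrow> 'a \<times> ('a \<Rightarrow> real)" assume IH: "\<And>y. y < n \<Longrightarrow> ?P F y (F y)"
    define x where "x m = fst (F m)" for m
    define f where "f m = snd (F m)" for m
    have VW: "V m \<subseteq> W" for m using openin_subset[OF V(1)[of m]] by simp
    have x: "x m \<in> W" and f: "dual (f m)" if "m < n" for m
      using IH[OF that] VW by (auto simp: x_def f_def)
    have ortho: "f m (x k) = (if k = m then 1 else 0)" if "m < n" "k < n" for m k
      using IH[OF that(1)] IH[OF that(2)] by (cases m k rule: linorder_cases) (auto simp: x_def f_def)
    obtain w where w: "w \<in> W" "w \<notin> span (x ` {..<n})"
      using not_finitely_spanned[of "x ` {..<n}"] x by auto
    define y where "y = w - (\<Sum>m<n. sc (f m w) (x m))"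
    have comb: "(\<Sum>m<n. sc (f m w) (x m)) \<in> span (x ` {..<n})"
      by (intro span_sum span_scale span_base) auto
    then have "y \<noteq> 0" using w(2) by (auto simp: y_def)
    have "y \<in> W" unfolding y_def
      using w(1) x by (intro subspace_diff subspace_sum subspace_scale subspace_W) auto
    have fy: "f k y = 0" if "k < n" for k
    proof -
      have "f k y = f k w - (\<Sum>m<n. f m w * f k (x m))"
        using f[OF that] by (simp add: y_def dual_diff[of "f k"] dual_sum[of "f k"] dual_scale[of "f k"])
      also have "(\<Sum>m<n. f m w * f k (x m)) = (\<Sum>m<n. if m = k then f m w else 0)"
        using that by (intro sum.cong) (auto simp: ortho)
      finally show ?thesis using that by simp
    qed
    obtain g where g: "dual g" "g y = 1" using separate_points[OF \<open>y \<noteq> 0\<close>] .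
    \<comment> \<open>The correction makes \<open>h\<close> vanish at every earlier
      \<open>x k\<close> and leaves the value at \<open>y\<close> unchanged, since
      \<open>f m y = 0\<close>.\<close>
    define h where "h = (\<lambda>z. g z - (\<Sum>m<n. g (x m) * f m z))"
    have h: "dual h" unfolding h_def using g(1) f by (intro dual_minus_sum) auto
    have hy: "h y = 1" using g(2) fy by (simp add: h_def)
    have hx: "h (x k) = 0" if "k < n" for k
    proof -
      have "(\<Sum>m<n. g (x m) * f m (x k)) = (\<Sum>m<n. if m = k then g (x m) else 0)"
        using that by (intro sum.cong) (auto simp: ortho)
      then show ?thesis using that by (simp add: h_def)
    qed
    obtain U where U: "openin T U" "V n = U \<inter> W" using V(1)[of n] by (auto simp: openin_subtopology)
    obtain c where c: "0 < c" "sc c y \<in> U"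
      using absorbing[OF U(1)] V(2)[of n] U(2) by blast
    have "sc c y \<in> V n" using c(2) U(2) subspace_scale[OF subspace_W \<open>y \<in> W\<close>] by simp
    moreover have "dual (\<lambda>z. (1 / c) * h z)" using h by (rule dual_cmult)
    ultimately have "?P F n (sc c y, \<lambda>z. (1 / c) * h z)"
      using c(1) hy hx fy h f
      by (simp add: dual_scale[of h] dual_scale[of "f _"] flip: x_def f_def)
    then show "\<exists>r. ?P F n r" by blast
  qed simp
  then obtain F where F: "\<And>n. ?P F n (F n)" by blast
  show thesis
  proof
    show "fst (F n) \<in> V n" "dual (snd (F n))" for n using F by blast+
    show "snd (F n) (fst (F m)) = (if m = n then 1 else 0)" for n m
      using F[of n] F[of m] by (cases m n rule: linorder_cases) auto
  qed
qed

text \<open>The index \<open>k + 2\<close> leaves one halving for the partial sums and one for their limit.\<close>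

lemma series_in_nbhd:
  assumes V: "\<And>n::nat. openin (subtopology T W) (V n)" "\<And>n. 0 \<in> V n"
    and half: "\<And>n x y t. x \<in> V (Suc n) \<Longrightarrow> y \<in> V (Suc n) \<Longrightarrow> 0 \<le> t \<Longrightarrow> t \<le> 1 \<Longrightarrow> sc t x + y \<in> V n"
    and base: "\<And>U. openin T U \<Longrightarrow> 0 \<in> U \<Longrightarrow> \<exists>n. V n \<subseteq> U"
    and x: "\<And>k. x k \<in> V (Suc (Suc k))"
    and s: "\<And>k. N \<le> k \<Longrightarrow> 0 \<le> s k \<and> s k \<le> 1"
  shows "\<exists>l\<in>V N. \<forall>f. dual f \<longrightarrow> (\<lambda>M. \<Sum>k=N..<M. s k * f (x k)) \<longlonglongrightarrow> f l"
proof -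
  let ?T = "subtopology T W"
  define S where "S M = (\<Sum>k=N..<M. sc (s k) (x k))" for M
  have VW: "V m \<subseteq> W" for m using openin_subset[OF V(1)[of m]] by simp
  have dec: "V (Suc n) \<subseteq> V n" for n
    using half[of 0 n _ 0] V(2) by auto
  have anti: "V n \<subseteq> V m" if "m \<le> n" for m n
    using dec that by (rule lift_Suc_antimono_le)
  \<comment> \<open>Downward induction on the starting index: the first term and the remaining sum
    both lie in \<open>V (Suc (Suc m))\<close>, and one halving puts the total into
    \<open>V (Suc m)\<close>, whatever the upper end \<open>M\<close>.\<close>
  have tail: "(\<Sum>k=m..<M. sc (s k) (x k)) \<in> V (Suc m)" if "N \<le> m" for m M
  proof (cases "m \<le> M")
    case True
    then show ?thesis
      using that
    proof (induction m rule: inc_induct)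
      case base
      then show ?case using V(2) by simp
    next
      case (step m)
      then have "(\<Sum>k=Suc m..<M. sc (s k) (x k)) \<in> V (Suc (Suc m))" by simp
      then have "sc (s m) (x m) + (\<Sum>k=Suc m..<M. sc (s k) (x k)) \<in> V (Suc m)"
        using x[of m] s[OF step.prems] by (intro half) auto
      then show ?case using step.hyps by (simp add: sum.atLeast_Suc_lessThan)
    qed
  qed (use V(2) in simp)
  have diff: "S M - S m \<in> V (Suc m)" if "N \<le> m" "m \<le> M" for m M
  proof -
    have "S M = S m + (\<Sum>k=m..<M. sc (s k) (x k))"
      using that by (simp add: S_def sum.atLeastLessThan_concat)
    then show ?thesis using tail[OF that(1)] by simp
  qed
  have S_W: "S M \<in> W" for M
    using tail[of N M] VW by (auto simp: S_def)
  have "cauchy_filter_in ?T (filtermap S sequentially)"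
    unfolding cauchy_filter_in_def
  proof (intro conjI allI impI)
    show "filtermap S sequentially \<noteq> bot" by (simp add: filtermap_bot_iff)
    fix U assume U: "openin ?T U \<and> 0 \<in> U"
    then obtain U' where U': "openin T U'" "U = U' \<inter> W" by (auto simp: openin_subtopology)
    \<comment> \<open>\<open>diff\<close> controls later minus earlier partial sums; symmetrising
      \<open>U'\<close> covers the opposite order.\<close>
    have "openin T (U' \<inter> {z. - z \<in> U'})" using U'(1) by (intro openin_Int openin_uminus)
    moreover have "0 \<in> U' \<inter> {z. - z \<in> U'}" using U U'(2) by simp
    ultimately obtain n where n: "V n \<subseteq> U' \<inter> {z. - z \<in> U'}" using base by blast
    let ?A = "S ` {max n N..}"
    have "a - b \<in> U" if ab: "a \<in> ?A" "b \<in> ?A" for a b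
    proof -
      obtain i j where ij: "a = S i" "b = S j" "max n N \<le> i" "max n N \<le> j" using ab by auto
      have "a - b \<in> V n \<or> b - a \<in> V n"
      proof (cases "j \<le> i")
        case True
        then show ?thesis using diff[of j i] anti[of n "Suc j"] ij by auto
      next
        case False
        then show ?thesis using diff[of i j] anti[of n "Suc i"] ij by auto
      qed
      then have "a - b \<in> U'" using n by auto
      moreover have "a - b \<in> W" using ij S_W by (auto intro: subspace_diff[OF subspace_W])
      ultimately show ?thesis using U'(2) by blast
    qed
    moreover have "?A \<subseteq> topspace ?T" using S_W by auto
    moreover have "\<forall>\<^sub>F z in filtermap S sequentially. z \<in> ?A"
      unfolding eventually_filtermap using eventually_ge_at_top[of "max n N"]
      by (rule eventually_mono) auto
    ultimately show "\<exists>A\<subseteq>topspace ?T. (\<forall>\<^sub>F z in filtermap S sequentially. z \<in> A) \<and>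
        (\<forall>a\<in>A. \<forall>b\<in>A. a - b \<in> U)" by blast
  qed
  then obtain l where "limitin ?T (\<lambda>z. z) l (filtermap S sequentially)"
    using complete unfolding uniformly_complete_def by blast
  then have "limitin ?T S l sequentially"
    by (simp add: limitin_def eventually_filtermap)
  then have "l \<in> W" and lim: "limitin T S l sequentially"
    by (simp_all add: limitin_subtopology)
  show ?thesis
  proof (intro bexI allI impI)
    show "(\<lambda>M. \<Sum>k=N..<M. s k * f (x k)) \<longlonglongrightarrow> f l" if "dual f" for f
    proof -
      have "limitin euclideanreal (f \<circ> S) (f l) sequentially"
        using dual_continuous[OF that] lim by (rule continuous_map_limit)
      then show ?thesis
        using that by (simp add: S_def o_def dual_sum[of f] dual_scale[of f])
    qed
    obtain U where U: "openin T U" "V (Suc N) = U \<inter> W"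
      using V(1)[of "Suc N"] by (auto simp: openin_subtopology)
    have ev: "\<forall>\<^sub>F M in sequentially. S M \<in> A" if "openin T A" "l \<in> A" for A
      using lim that by (simp add: limitin_def)
    \<comment> \<open>Some partial sum differs from \<open>l\<close> by an element of
      \<open>V (Suc N)\<close>. As the partial sum lies in \<open>V (Suc N)\<close> too, the
      remaining halving puts \<open>l\<close> into \<open>V N\<close>.\<close>
    have "\<forall>\<^sub>F M in sequentially. S M \<in> {z. sc (- 1) z + l \<in> U}"
    proof (rule ev)
      show "openin T {z. sc (- 1) z + l \<in> U}" using U(1) by (rule openin_affine)
      show "l \<in> {z. sc (- 1) z + l \<in> U}" using V(2)[of "Suc N"] U(2) by simp
    qed
    from eventually_happens'[OF sequentially_bot this]
    obtain M where "sc (- 1) (S M) + l \<in> U" by auto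
    then have "l - S M \<in> V (Suc N)"
      using U(2) subspace_diff[OF subspace_W \<open>l \<in> W\<close> S_W[of M]] by simp
    moreover have "S M \<in> V (Suc N)" using tail[of N M] by (simp add: S_def)
    ultimately show "l \<in> V N" using half[of "l - S M" N "S M" 1] by simp
  qed
qed

text \<open>The last property is openness at \<open>0\<close> in coordinates: finitely many of them
  have to be small, of either sign, and the others range over \<open>[0, 1]\<close>. A short linear
  combination realises the former and a tail of the series the latter.\<close>

lemma ex_open_coordinates:
  obtains f :: "nat \<Rightarrow> 'a \<Rightarrow> real" where "\<And>n. dual (f n)"
    "\<And>s. (\<And>k. 0 \<le> s k \<and> s k \<le> 1) \<Longrightarrow> \<exists>z. \<forall>n. f n z = s n"
    "\<And>U. openin T U \<Longrightarrow> 0 \<in> U \<Longrightarrow> \<exists>N e. 0 < e \<and>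
       (\<forall>s. (\<forall>k<N. \<bar>s k\<bar> < e) \<and> (\<forall>k\<ge>N. 0 \<le> s k \<and> s k \<le> 1) \<longrightarrow> (\<exists>z\<in>U. \<forall>n. f n z = s n))"
proof -
  obtain V where V: "\<And>n::nat. openin (subtopology T W) (V n)" "\<And>n. 0 \<in> V n"
    and half: "\<And>n x y t. x \<in> V (Suc n) \<Longrightarrow> y \<in> V (Suc n) \<Longrightarrow> 0 \<le> t \<Longrightarrow> t \<le> 1 \<Longrightarrow> sc t x + y \<in> V n"
    and base: "\<And>U. openin T U \<Longrightarrow> 0 \<in> U \<Longrightarrow> \<exists>n. V n \<subseteq> U"
    using ex_nbhd_base by blast
  obtain x f where x: "\<And>n. x n \<in> V (Suc (Suc n))" and f: "\<And>n. dual (f n)"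
    and ortho: "\<And>n m. f n (x m) = (if m = n then 1 else 0)"
    using ex_biorthogonal[of "\<lambda>n. V (Suc (Suc n))"] V by blast
  have series: "\<exists>l\<in>V N. \<forall>n. f n l = (if n < N then 0 else s n)"
    if s: "\<And>k. N \<le> k \<Longrightarrow> 0 \<le> s k \<and> s k \<le> 1" for N s
  proof -
    have "\<exists>l\<in>V N. \<forall>f. dual f \<longrightarrow> (\<lambda>M. \<Sum>k=N..<M. s k * f (x k)) \<longlonglongrightarrow> f l"
      by (rule series_in_nbhd) (fact V half base x s)+
    then obtain l where l: "l \<in> V N"
      "\<And>f. dual f \<Longrightarrow> (\<lambda>M. \<Sum>k=N..<M. s k * f (x k)) \<longlonglongrightarrow> f l"
      by auto
    have "f n l = (if n < N then 0 else s n)" for n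
    proof (rule LIMSEQ_unique[OF l(2)[OF f]])
      \<comment> \<open>By biorthogonality the partial sums are constant in \<open>M\<close> once
        \<open>M > n\<close>.\<close>
      have "\<forall>\<^sub>F M in sequentially. (if n < N then 0 else s n) = (\<Sum>k=N..<M. s k * f n (x k))"
        using eventually_gt_at_top[of n] by (rule eventually_mono) (auto simp: ortho if_distrib cong: if_cong)
      then show "(\<lambda>M. \<Sum>k=N..<M. s k * f n (x k)) \<longlonglongrightarrow> (if n < N then 0 else s n)"
        by (rule Lim_transform_eventually[OF tendsto_const])
    qed
    then show ?thesis using l(1) by blast
  qed
  show thesis
  proof
    show "dual (f n)" for n by (rule f)
    show "\<exists>z. \<forall>n. f n z = s n" if "\<And>k. 0 \<le> s k \<and> s k \<le> 1" for s
      using series[of 0 s] that by auto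
    fix U assume U: "openin T U" "0 \<in> U"
    obtain U' where U': "openin T U'" "0 \<in> U'"
      and sub: "\<And>x y t. x \<in> U' \<Longrightarrow> y \<in> U' \<Longrightarrow> 0 \<le> t \<Longrightarrow> t \<le> 1 \<Longrightarrow> sc t x + y \<in> U"
      using half_nbhd[OF U] by blast
    obtain N where N: "V N \<subseteq> U'" using base[OF U'] by blast
    obtain e where e: "0 < e" "\<And>s. (\<And>k. k < N \<Longrightarrow> \<bar>s k\<bar> < e) \<Longrightarrow> (\<Sum>k<N. sc (s k) (x k)) \<in> U'"
      using small_combination[OF U', where N = N and x = x] by blast
    have "\<exists>z\<in>U. \<forall>n. f n z = s n"
      if s: "\<forall>k<N. \<bar>s k\<bar> < e" "\<forall>k\<ge>N. 0 \<le> s k \<and> s k \<le> 1" for s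
    proof -
      obtain l where l: "l \<in> V N" "\<And>n. f n l = (if n < N then 0 else s n)"
        using series[of N s] s(2) by blast
      \<comment> \<open>The head carries the coordinates below \<open>N\<close> and \<open>l\<close>
        the others; the factor \<open>sc 1\<close> only matches the form of
        \<open>sub\<close>.\<close>
      let ?z = "sc 1 (\<Sum>k<N. sc (s k) (x k)) + l"
      have "?z \<in> U" using l(1) N s(1) by (intro sub e(2)) auto
      moreover have "f n ?z = s n" for n
        using f[of n] by (simp add: dual_add[of "f n"] dual_sum[of "f n"] dual_scale[of "f n"] ortho l(2)
            if_distrib cong: if_cong)
      ultimately show ?thesis by blast
    qed
    then show "\<exists>N e. 0 < e \<and>
       (\<forall>s. (\<forall>k<N. \<bar>s k\<bar> < e) \<and> (\<forall>k\<ge>N. 0 \<le> s k \<and> s k \<le> 1) \<longrightarrow> (\<exists>z\<in>U. \<forall>n. f n z = s n))"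
      using e(1) by blast
  qed
qed

end

section \<open>The quotient map onto the torus\<close>

lemma group_additive_group: "group (additive_group (UNIV :: 'e::ab_group_add set))"
  by (rule groupI) (auto simp: additive_group_def algebra_simps intro: exI[of _ "- _"])

lemma group_circle_group: "group circle_group"
proof (rule groupI)
  fix z assume z: "z \<in> carrier circle_group"
  then have "z \<noteq> 0" by (auto simp: circle_group_def)
  with z have "inverse z \<in> carrier circle_group" "inverse z \<otimes>\<^bsub>circle_group\<^esub> z = \<one>\<^bsub>circle_group\<^esub>"
    by (auto simp: circle_group_def norm_inverse)
  then show "\<exists>w\<in>carrier circle_group. w \<otimes>\<^bsub>circle_group\<^esub> z = \<one>\<^bsub>circle_group\<^esub>" ..
qed (auto simp: circle_group_def norm_mult)

lemma group_torus_omega: "group torus_omega"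
  unfolding torus_omega_def by (intro product_group group_circle_group)

lemma carrier_torus_omega: "carrier torus_omega = {w. \<forall>n. norm (w n) = 1}"
  by (auto simp: torus_omega_def circle_group_def PiE_def Pi_def)

lemma topspace_torus_omega: "topspace torus_omega_topology = carrier torus_omega"
  by (auto simp: carrier_torus_omega torus_omega_topology_def PiE_def Pi_def)

lemma Hausdorff_torus_omega: "Hausdorff_space torus_omega_topology"
  unfolding torus_omega_topology_def
  by (auto simp: Hausdorff_space_product_topology intro: Hausdorff_space_subtopology)

text \<open>A topological first isomorphism theorem. The kernel is closed because points of
  \<open>S\<close> are. The homomorphism and the coset projection are both quotient maps, so the
  induced bijection is an injective quotient map, that is, a homeomorphism.\<close>

lemma has_quotient_group_open_hom:
  assumes G: "group G" "topspace T = carrier G"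
    and H: "group H" "topspace S = carrier H" "t1_space S"
    and hom: "h \<in> hom G H" and surj: "h ` carrier G = carrier H"
    and cont: "continuous_map T S h" and opn: "open_map T S h"
  shows "has_quotient_group G T H S"
proof -
  interpret group_hom G H h
    using G(1) H(1) hom by (simp add: group_hom_def group_hom_axioms_def)
  let ?N = "kernel G H h"
  let ?\<pi> = "\<lambda>x. ?N #>\<^bsub>G\<^esub> x"
  let ?g = "\<lambda>X. the_elem (h ` X)"
  let ?Q = "quotient_group_topology G T ?N"
  have "closedin S {\<one>\<^bsub>H\<^esub>}"
    using H(2,3) by (simp add: closedin_t1_singleton)
  then have "closedin T {x \<in> topspace T. h x \<in> {\<one>\<^bsub>H\<^esub>}}"
    using cont by (rule closedin_continuous_map_preimage[rotated])
  then have closed: "closedin T ?N" by (simp add: kernel_def G(2))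
  have iso: "?g \<in> iso (G Mod ?N) H" using surj by (rule FactGroup_iso_set)
  have \<pi>: "quotient_map T ?Q ?\<pi>" using G(2) by (rule quotient_map_quotient_group_topology)
  \<comment> \<open>Each coset has a one-point image, so \<open>?g\<close> after the projection is
    \<open>h\<close>.\<close>
  have image: "h ` ?\<pi> x = {h x}" if x: "x \<in> carrier G" for x
  proof
    show "h ` ?\<pi> x \<subseteq> {h x}" using x by (auto simp: r_coset_def kernel_def)
    have "x \<in> ?\<pi> x" using subgroup_kernel x by (rule G.rcos_self[rotated])
    then show "{h x} \<subseteq> h ` ?\<pi> x" by blast
  qed
  have "quotient_map T S h"
    using cont opn surj by (intro continuous_open_imp_quotient_map) (simp_all add: G H)
  then have "quotient_map T S (?g \<circ> ?\<pi>)"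
    by (rule quotient_map_eq) (simp add: G(2) image)
  then have "quotient_map ?Q S ?g" using \<pi> by (simp add: quotient_map_compose_eq)
  moreover have "topspace ?Q = carrier (G Mod ?N)"
    using quotient_imp_surjective_map[OF \<pi>] by (auto simp: G(2) FactGroup_def RCOSETS_def)
  then have "inj_on ?g (topspace ?Q)" using iso by (simp add: iso_def bij_betw_def)
  ultimately have "homeomorphic_map ?Q S ?g"
    by (simp add: homeomorphic_map_def)
  then show ?thesis
    unfolding has_quotient_group_def using normal_kernel closed iso by blast
qed

section \<open>Arguments of unimodular numbers and basic open sets of the torus\<close>

lemma cis_Arg2pi: "norm z = 1 \<Longrightarrow> cis (Arg2pi z) = z"
  by (simp add: cis_conv_exp complex_norm_eq_1_exp)

text \<open>\<open>Arg\<close> is continuous at \<open>1\<close>, where \<open>Arg2pi\<close> jumps;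
  coordinates that must stay small are therefore measured by \<open>Arg\<close>.\<close>

lemma small_Arg:
  assumes "0 < e"
  obtains d where "0 < d" "\<And>z. norm (z - 1) < d \<Longrightarrow> \<bar>Arg z\<bar> < e"
proof -
  have "continuous (at 1) Arg" by (rule continuous_at_Arg) simp
  then obtain d where "0 < d" "\<And>z. dist z 1 < d \<Longrightarrow> dist (Arg z) (Arg 1) < e"
    unfolding continuous_at_eps_delta using assms by blast
  then show thesis using that by (simp add: dist_norm)
qed

lemma openin_torus_omega_ball:
  "openin torus_omega_topology {w \<in> carrier torus_omega. \<forall>k<N. norm (w k - v k) < d}"
proof -
  have "{w \<in> carrier torus_omega. \<forall>k<N. norm (w k - v k) < d} =
      (\<Pi>\<^sub>E k\<in>UNIV. if k < N then sphere 0 1 \<inter> ball (v k) d else sphere 0 1)"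
    by (auto simp: carrier_torus_omega PiE_def Pi_def dist_norm norm_minus_commute split: if_splits)
  moreover have "openin torus_omega_topology \<dots>"
    unfolding torus_omega_topology_def
  proof (rule product_topology_basis)
    show "openin (top_of_set (sphere 0 1)) (if k < N then sphere 0 1 \<inter> ball (v k) d else sphere 0 1)" for k
      by (auto simp: openin_open_Int)
    show "finite {k. (if k < N then sphere 0 1 \<inter> ball (v k) d else sphere 0 1) \<noteq>
        topspace (top_of_set (sphere (0 :: complex) 1))}"
      by (rule finite_subset[of _ "{..<N}"]) auto
  qed
  ultimately show ?thesis by simp
qed

section \<open>The open homomorphism given by the functionals\<close>

context frechet_subspace
begin

lemma has_torus_quotient:
  "has_quotient_group (additive_group UNIV) T torus_omega torus_omega_topology"
proof -
  obtain f :: "nat \<Rightarrow> 'a \<Rightarrow> real" where f: "\<And>n. dual (f n)"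
    and onto: "\<And>s. (\<And>k. 0 \<le> s k \<and> s k \<le> 1) \<Longrightarrow> \<exists>z. \<forall>n. f n z = s n"
    and opn: "\<And>U. openin T U \<Longrightarrow> 0 \<in> U \<Longrightarrow> \<exists>N e. 0 < e \<and>
       (\<forall>s. (\<forall>k<N. \<bar>s k\<bar> < e) \<and> (\<forall>k\<ge>N. 0 \<le> s k \<and> s k \<le> 1) \<longrightarrow> (\<exists>z\<in>U. \<forall>n. f n z = s n))"
    using ex_open_coordinates by blast
  define h where "h x = (\<lambda>n. cis (2 * pi * f n x))" for x
  have h_add: "h (x + y) n = h x n * h y n" for x y n
    by (simp add: h_def dual_add[OF f] cis_mult distrib_left)
  have h_car: "h x \<in> carrier torus_omega" for x
    by (simp add: h_def carrier_torus_omega)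
  have hom: "h \<in> hom (additive_group UNIV) torus_omega"
    using h_car by (intro homI) (auto simp: additive_group_def torus_omega_def circle_group_def h_add)
  have surj: "\<exists>x. h x = w" if "w \<in> carrier torus_omega" for w
  proof -
    have "\<exists>z. \<forall>n. f n z = Arg2pi (w n) / (2 * pi)"
      by (rule onto) (simp add: Arg2pi_ge_0 less_imp_le[OF Arg2pi_lt_2pi])
    then obtain z where "\<And>n. f n z = Arg2pi (w n) / (2 * pi)" by blast
    then have "h z = w" using that by (auto simp: h_def carrier_torus_omega cis_Arg2pi)
    then show ?thesis ..
  qed
  have cont: "continuous_map T torus_omega_topology h"
    unfolding torus_omega_topology_def continuous_map_componentwise_UNIV
  proof
    fix n
    have "continuous_map euclideanreal (top_of_set (sphere 0 1)) (\<lambda>t. cis (2 * pi * t))"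
      by (auto simp: continuous_map_in_subtopology intro!: continuous_intros)
    from continuous_map_compose[OF dual_continuous[OF f[of n]] this]
    show "continuous_map T (top_of_set (sphere 0 1)) (\<lambda>x. h x n)"
      by (simp add: h_def o_def)
  qed
  have "open_map T torus_omega_topology h"
    unfolding open_map_def
  proof (intro allI impI)
    fix U assume U: "openin T U"
    show "openin torus_omega_topology (h ` U)"
    proof (subst openin_subopen, intro ballI)
      fix v assume "v \<in> h ` U"
      then obtain x where x: "x \<in> U" "v = h x" by blast
      \<comment> \<open>Openness at \<open>x\<close> is reduced to openness at \<open>0\<close> by
        translating \<open>U\<close> by \<open>x\<close>.\<close>
      have "\<exists>N e. 0 < e \<and> (\<forall>s. (\<forall>k<N. \<bar>s k\<bar> < e) \<and> (\<forall>k\<ge>N. 0 \<le> s k \<and> s k \<le> 1) \<longrightarrow>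
          (\<exists>z\<in>{z. sc 1 z + x \<in> U}. \<forall>n. f n z = s n))"
      proof (rule opn)
        show "openin T {z. sc 1 z + x \<in> U}" using U by (rule openin_affine)
        show "0 \<in> {z. sc 1 z + x \<in> U}" using x(1) by simp
      qed
      then obtain N e where e: "0 < e" and
        sol: "\<forall>s. (\<forall>k<N. \<bar>s k\<bar> < e) \<and> (\<forall>k\<ge>N. 0 \<le> s k \<and> s k \<le> 1) \<longrightarrow>
          (\<exists>z\<in>{z. sc 1 z + x \<in> U}. \<forall>n. f n z = s n)"
        by (elim exE conjE) (rule that)
      have "0 < 2 * pi * e" using e by simp
      then obtain d where d: "0 < d" "\<And>z. norm (z - 1) < d \<Longrightarrow> \<bar>Arg z\<bar> < 2 * pi * e"
        using small_Arg by blast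
      let ?B = "{w \<in> carrier torus_omega. \<forall>k<N. norm (w k - v k) < d}"
      have v: "norm (v k) = 1" for k using h_car[of x] x(2) by (simp add: carrier_torus_omega)
      have "w \<in> h ` U" if w: "w \<in> ?B" for w
      proof -
        \<comment> \<open>The displacement from \<open>v\<close> to \<open>w\<close> in the torus,
          to be realised as \<open>h z\<close>.\<close>
        define u where "u k = w k / v k" for k
        have u: "norm (u k) = 1" for k
          using w v by (simp add: u_def carrier_torus_omega norm_divide)
        have uv: "u k * v k = w k" for k using v[of k] by (auto simp: u_def)
        \<comment> \<open>Two choices of logarithm: below \<open>N\<close> the principal one, small
          near \<open>1\<close> but possibly negative; from \<open>N\<close> on the one in
          \<open>[0, 2 * pi)\<close>, which suits every point of the circle.\<close>
        define s where "s k = (if k < N then Arg (u k) else Arg2pi (u k)) / (2 * pi)" for k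
        have cis_s: "cis (2 * pi * s k) = u k" for k
        proof -
          have "u k \<noteq> 0" using u[of k] by auto
          then have "cis (Arg (u k)) = u k" using u[of k] by (simp add: cis_Arg sgn_eq)
          then show ?thesis using u[of k] by (simp add: s_def cis_Arg2pi)
        qed
        have small: "\<bar>s k\<bar> < e" if k: "k < N" for k
        proof -
          have "v k \<noteq> 0" using v[of k] by auto
          then have "u k - 1 = (w k - v k) / v k" by (simp add: u_def diff_divide_distrib)
          then have "norm (u k - 1) = norm (w k - v k)" using v[of k] by (simp add: norm_divide)
          then have "\<bar>Arg (u k)\<bar> < 2 * pi * e" using w k by (intro d(2)) simp
          then show ?thesis using k by (simp add: s_def abs_divide field_simps)
        qed
        moreover have "0 \<le> s k \<and> s k \<le> 1" if "N \<le> k" for k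
          using that by (simp add: s_def Arg2pi_ge_0 less_imp_le[OF Arg2pi_lt_2pi])
        ultimately have "\<exists>z\<in>{z. sc 1 z + x \<in> U}. \<forall>n. f n z = s n"
          using sol[THEN spec, of s] by simp
        then obtain z where z: "sc 1 z + x \<in> U" "\<And>n. f n z = s n" by auto
        have "h z k = u k" for k by (simp add: h_def z(2) cis_s)
        then have "h (z + x) = w" using x(2) uv by (auto simp: h_add)
        then show ?thesis using z(1) by auto
      qed
      then have "?B \<subseteq> h ` U" by blast
      moreover have "v \<in> ?B" using d(1) h_car[of x] x(2) by simp
      ultimately show "\<exists>B. openin torus_omega_topology B \<and> v \<in> B \<and> B \<subseteq> h ` U"
        using openin_torus_omega_ball by blast
    qed
  qed
  then show ?thesis
    using group_additive_group group_torus_omega hom cont surj h_car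
    by (intro has_quotient_group_open_hom[where h = h])
      (auto simp: topspace_torus_omega additive_group_def
        intro: Hausdorff_imp_t1_space[OF Hausdorff_torus_omega])
qed

end

text \<open>Complex scalars are restricted to the reals; a finite real basis would span over the larger field.\<close>

lemma has_torus_quotient_if_frechet_subspace:
  fixes sc :: "'f::real_normed_field \<Rightarrow> 'e::ab_group_add \<Rightarrow> 'e"
  assumes E: "locally_convex_space sc UNIV T" "Hausdorff_space T"
    and W: "module.subspace sc W" "frechet_space sc W (subtopology T W)" "infinite_dimensional sc W"
  shows "has_quotient_group (additive_group (UNIV :: 'e set)) T torus_omega torus_omega_topology"
proof -
  define rs where "rs r = sc (of_real r)" for r
  have tvs: "topological_vector_space sc UNIV T"
    using E(1) by (simp add: locally_convex_space_def)
  then interpret F: vector_space sc by (simp add: topological_vector_space_def)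
  interpret R: vector_space rs
    by unfold_locales (simp_all add: rs_def F.scale_right_distrib F.scale_left_distrib)
  have "continuous_map (prod_topology euclideanreal T) (prod_topology euclidean T) (\<lambda>(r, x). (of_real r :: 'f, x))"
    unfolding case_prod_unfold
    by (intro continuous_map_pairedI continuous_map_compose[OF continuous_map_fst, unfolded o_def]
        continuous_map_snd) (auto intro: continuous_intros)
  from continuous_map_compose[OF this] tvs
  have scale: "continuous_map (prod_topology euclideanreal T) T (\<lambda>(r, x). rs r x)"
    by (fastforce simp: topological_vector_space_def rs_def o_def case_prod_unfold)
  have convex: "convex_wrt rs C = convex_wrt sc C" for C
    by (simp add: convex_wrt_def rs_def)
  have sub: "R.subspace W"
    using W(1) by (simp add: R.subspace_def F.subspace_def rs_def)
  have "infinite_dimensional rs W"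
    unfolding infinite_dimensional_def
  proof
    assume "\<exists>B. finite B \<and> \<not> R.dependent B \<and> R.span B = W"
    then obtain B where B: "finite B" "R.span B = W" by blast
    have "R.subspace (F.span B)"
      by (simp add: R.subspace_def rs_def F.span_zero F.span_add F.span_scale)
    then have "W \<subseteq> F.span B"
      using R.span_minimal[OF F.span_superset] B(2) by blast
    moreover have "F.span B \<subseteq> W"
      using F.span_minimal[OF _ W(1)] R.span_superset B(2) by blast
    \<comment> \<open>A set that spans \<open>W\<close> over the reals also spans it over the larger
      field but may become dependent there, so it is thinned.\<close>
    moreover obtain B' where "B' \<subseteq> B" "F.independent B'" "F.span B' = F.span B"
      by (metis F.maximal_independent_subset F.span_mono F.span_minimal F.subspace_span subset_antisym)
    ultimately show False
      using W(3) B(1) unfolding infinite_dimensional_def by (metis finite_subset subset_antisym)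
  qed
  then interpret frechet_subspace rs T W
    using E W tvs scale sub
    by unfold_locales (auto simp: locally_convex_space_def topological_vector_space_def
        frechet_space_def convex)
  show ?thesis by (rule has_torus_quotient)
qed

theorem theorem2p1:
  shows "(\<forall>(sc :: real \<Rightarrow> 'e::ab_group_add \<Rightarrow> 'e) T W.
            locally_convex_space sc UNIV T \<and> Hausdorff_space T \<and>
            module.subspace sc W \<and> frechet_space sc W (subtopology T W) \<and>
            infinite_dimensional sc W \<longrightarrow>
            has_quotient_group (additive_group (UNIV :: 'e set)) T torus_omega torus_omega_topology) \<and>
         (\<forall>(sc :: complex \<Rightarrow> 'e \<Rightarrow> 'e) T W.
            locally_convex_space sc UNIV T \<and> Hausdorff_space T \<and>
            module.subspace sc W \<and> frechet_space sc W (subtopology T W) \<and>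
            infinite_dimensional sc W \<longrightarrow>
            has_quotient_group (additive_group (UNIV :: 'e set)) T torus_omega torus_omega_topology)"
  by (intro conjI allI impI; elim conjE; rule has_torus_quotient_if_frechet_subspace; assumption)

end
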